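(* Let $\Delta t>0$ and $n\ge 0$. Given $\phi^n,\phi^{n-1}\in\mathcal G_N$ with $\overline{\phi^n}=\overline{\phi^{n-1}}$ and two scalar values $r^n,r^{n-1}\in\mathbb R$, set $\hat\phi^{n+1}=2\phi^n-\phi^{n-1}$. Then there exists a unique solution $\phi^{n+1}\in\mathcal G_N$ (together with the scalar $r^{n+1}\in\mathbb R$) of the numerical scheme $$\frac{\frac32\phi^{n+1}-2\phi^n+\frac12\phi^{n-1}}{\Delta t}=\Delta_N\Big(\frac{r^{n+1}}{\sqrt{E_{1,N}(\hat\phi^{n+1})}}\,N_N(\hat\phi^{n+1})+L_N\phi^{n+1}\Big),$$ $$\frac{\frac32 r^{n+1}-2r^n+\frac12 r^{n-1}}{\Delta t}=\frac{1}{2\sqrt{E_{1,N}(\hat\phi^{n+1})}}\Big\langle N_N(\hat\phi^{n+1}),\frac{\frac32\phi^{n+1}-2\phi^n+\frac12\phi^{n-1}}{\Delta t}\Big\rangle .$$ Moreover, the scheme is mass conservative: if $\overline{\phi^{-1}}=\overline{\phi^0}=:\beta_0$, then the solution generated by the scheme for $n=0,1,2,\dots$ satisfies $\overline{\phi^k}=\overline{\phi^0}=\beta_0$ for all $k\ge 0$.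
   Context: Let $\Omega=(0,1)^3$ ($|\Omega|=1$), $N=2K+1$ with $K\in\mathbb N$, $h=1/N$, grid points $(x_i,y_j,z_k)=(ih,jh,kh)$. $\mathcal G_N$ is the space of real grid functions $f:\mathbb Z^3\to\mathbb R$ that are $N$-periodic in each index. For $f,g\in\mathcal G_N$: $\langle f,g\rangle=h^3\sum_{i,j,k=0}^{N-1}f_{i,j,k}g_{i,j,k}$, $\|f\|_p=(h^3\sum_{i,j,k=0}^{N-1}|f_{i,j,k}|^p)^{1/p}$ (for vector-valued grid functions $|\cdot|$ is the Euclidean norm), and $\overline f=\langle f,1\rangle$. Every $f\in\mathcal G_N$ has the discrete Fourier expansion $f_{i,j,k}=\sum_{\ell,m,n=-K}^K\hat f^N_{\ell,m,n}e^{2\pi\mathrm i(\ell x_i+my_j+nz_k)}$. The Fourier pseudo-spectral derivative $\mathcal D_x$ multiplies $\hat f^N_{\ell,m,n}$ by $2\pi\mathrm i\ell$ (similarly $\mathcal D_y,\mathcal D_z$ with $m,n$); $\nabla_N f=(\mathcal D_xf,\mathcal D_yf,\mathcal D_zf)^T$, $\nabla_N\cdot(f_1,f_2,f_3)^T=\mathcal D_xf_1+\mathcal D_yf_2+\mathcal D_zf_3$, $\Delta_N=\nabla_N\cdot\nabla_N$. The constant $a=1-\varepsilon$, $0<\varepsilon<1$, is a fixed parameter, so $0<a<1$. Define $N_N(\phi)=-\nabla_N\cdot(|\nabla_N\phi|^2\nabla_N\phi)+2\Delta_N\phi$ (pointwise products on the grid), $L_N\phi=a\phi+\Delta_N^2\phi$,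 and $E_{1,N}(\phi)=\frac14\|\nabla_N\phi\|_4^4-\|\nabla_N\phi\|_2^2+2|\Omega|$ (which satisfies $E_{1,N}(\phi)\ge|\Omega|>0$). *)

theory Defs
  imports "HOL-Analysis.Analysis"
begin

text \<open>
  Throughout, \<open>K\<close> determines the (odd) number \<open>N = 2 K + 1\<close> of grid points per direction.
\<close>

type_synonym 'a grid_fun = "int \<Rightarrow> int \<Rightarrow> int \<Rightarrow> 'a"

definition Omega :: "(real ^ 3) set" where
  "Omega = box 0 1"

definition grid_N :: "nat \<Rightarrow> nat" where
  "grid_N K = 2 * K + 1"

definition grid_h :: "nat \<Rightarrow> real" where
  "grid_h K = 1 / real (grid_N K)"

definition grid_space :: "nat \<Rightarrow> real grid_fun set" where
  "grid_space K = {f. \<forall>i j k. f (i + int (grid_N K)) j k = f i j k \<and>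
                              f i (j + int (grid_N K)) k = f i j k \<and>
                              f i j (k + int (grid_N K)) = f i j k}"

definition grid_sum :: "nat \<Rightarrow> 'a::comm_monoid_add grid_fun \<Rightarrow> 'a" where
  "grid_sum K f = (\<Sum>i\<in>{0..<int (grid_N K)}. \<Sum>j\<in>{0..<int (grid_N K)}.
                     \<Sum>k\<in>{0..<int (grid_N K)}. f i j k)"

definition grid_inner :: "nat \<Rightarrow> real grid_fun \<Rightarrow> real grid_fun \<Rightarrow> real" where
  "grid_inner K f g = grid_h K ^ 3 * grid_sum K (\<lambda>i j k. f i j k * g i j k)"

definition grid_mean :: "nat \<Rightarrow> real grid_fun \<Rightarrow> real" where
  "grid_mean K f = grid_inner K f (\<lambda>i j k. 1)"

definition grid_norm :: "nat \<Rightarrow> real \<Rightarrow> 'a::real_normed_vector grid_fun \<Rightarrow> real" where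
  "grid_norm K p f =
     (grid_h K ^ 3 * grid_sum K (\<lambda>i j k. norm (f i j k) powr p)) powr (1 / p)"

definition fourier_mode :: "nat \<Rightarrow> int \<Rightarrow> int \<Rightarrow> int \<Rightarrow> complex grid_fun" where
  "fourier_mode K l m n i j k =
     exp (2 * complex_of_real pi * \<i> *
          complex_of_real (of_int l * (of_int i * grid_h K) + of_int m * (of_int j * grid_h K)
                           + of_int n * (of_int k * grid_h K)))"

definition freq_sum :: "nat \<Rightarrow> (int \<Rightarrow> int \<Rightarrow> int \<Rightarrow> complex) \<Rightarrow> complex" where
  "freq_sum K F = (\<Sum>l\<in>{-int K..int K}. \<Sum>m\<in>{-int K..int K}. \<Sum>n\<in>{-int K..int K}. F l m n)"

text \<open>
  The coefficients of the discrete Fourier expansion, by the inversion formula; they are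
  justified by \<open>fourier_expansion\<close> and \<open>fourier_coeff_unique\<close> below.
\<close>

definition fourier_coeff :: "nat \<Rightarrow> real grid_fun \<Rightarrow> int \<Rightarrow> int \<Rightarrow> int \<Rightarrow> complex" where
  "fourier_coeff K f l m n =
     complex_of_real (grid_h K ^ 3) *
     grid_sum K (\<lambda>i j k. complex_of_real (f i j k) * fourier_mode K (-l) (-m) (-n) i j k)"

definition spectral_sum ::
  "nat \<Rightarrow> (int \<Rightarrow> int \<Rightarrow> int \<Rightarrow> complex) \<Rightarrow> real grid_fun \<Rightarrow> complex grid_fun" where
  "spectral_sum K s f i j k =
     freq_sum K (\<lambda>l m n. s l m n * fourier_coeff K f l m n * fourier_mode K l m n i j k)"

text \<open>
  \<open>Re\<close> below only changes the type: the sums are real because the set of frequencies is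
  symmetric, see \<open>spectral_sum_real\<close>.
\<close>

definition D_x :: "nat \<Rightarrow> real grid_fun \<Rightarrow> real grid_fun" where
  "D_x K f i j k = Re (spectral_sum K (\<lambda>l m n. 2 * complex_of_real pi * \<i> * of_int l) f i j k)"

definition D_y :: "nat \<Rightarrow> real grid_fun \<Rightarrow> real grid_fun" where
  "D_y K f i j k = Re (spectral_sum K (\<lambda>l m n. 2 * complex_of_real pi * \<i> * of_int m) f i j k)"

definition D_z :: "nat \<Rightarrow> real grid_fun \<Rightarrow> real grid_fun" where
  "D_z K f i j k = Re (spectral_sum K (\<lambda>l m n. 2 * complex_of_real pi * \<i> * of_int n) f i j k)"

definition grid_grad :: "nat \<Rightarrow> real grid_fun \<Rightarrow> (real ^ 3) grid_fun" where
  "grid_grad K f i j k = vector [D_x K f i j k, D_y K f i j k, D_z K f i j k]"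

definition grid_div :: "nat \<Rightarrow> (real ^ 3) grid_fun \<Rightarrow> real grid_fun" where
  "grid_div K F i j k =
     D_x K (\<lambda>i j k. F i j k $ 1) i j k + D_y K (\<lambda>i j k. F i j k $ 2) i j k
     + D_z K (\<lambda>i j k. F i j k $ 3) i j k"

definition grid_lap :: "nat \<Rightarrow> real grid_fun \<Rightarrow> real grid_fun" where
  "grid_lap K f = grid_div K (grid_grad K f)"

definition op_N :: "nat \<Rightarrow> real grid_fun \<Rightarrow> real grid_fun" where
  "op_N K \<phi> i j k =
     - grid_div K (\<lambda>i j k. (norm (grid_grad K \<phi> i j k))\<^sup>2 *\<^sub>R grid_grad K \<phi> i j k) i j k
     + 2 * grid_lap K \<phi> i j k"

definition op_L :: "nat \<Rightarrow> real \<Rightarrow> real grid_fun \<Rightarrow> real grid_fun" where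
  "op_L K a \<phi> i j k = a * \<phi> i j k + grid_lap K (grid_lap K \<phi>) i j k"

definition E1 :: "nat \<Rightarrow> real grid_fun \<Rightarrow> real" where
  "E1 K \<phi> = 1 / 4 * grid_norm K 4 (grid_grad K \<phi>) ^ 4 - (grid_norm K 2 (grid_grad K \<phi>))\<^sup>2
            + 2 * measure lebesgue Omega"

definition bdf2 :: "real \<Rightarrow> real \<Rightarrow> real \<Rightarrow> real \<Rightarrow> real" where
  "bdf2 dt u_new u_cur u_prev = (3 / 2 * u_new - 2 * u_cur + 1 / 2 * u_prev) / dt"

definition bdf2_grid ::
  "real \<Rightarrow> real grid_fun \<Rightarrow> real grid_fun \<Rightarrow> real grid_fun \<Rightarrow> real grid_fun" where
  "bdf2_grid dt u_new u_cur u_prev i j k = bdf2 dt (u_new i j k) (u_cur i j k) (u_prev i j k)"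

definition extrapolate :: "real grid_fun \<Rightarrow> real grid_fun \<Rightarrow> real grid_fun" where
  "extrapolate \<phi>_cur \<phi>_prev i j k = 2 * \<phi>_cur i j k - \<phi>_prev i j k"

text \<open>One step from the two previous time levels \<open>cur\<close> = $n$, \<open>prev\<close> = $n-1$ to \<open>new\<close> = $n+1$.\<close>

definition sav_scheme ::
  "nat \<Rightarrow> real \<Rightarrow> real \<Rightarrow> real grid_fun \<Rightarrow> real grid_fun \<Rightarrow> real \<Rightarrow> real
     \<Rightarrow> real grid_fun \<Rightarrow> real \<Rightarrow> bool" where
  "sav_scheme K a dt \<phi>_prev \<phi>_cur r_prev r_cur \<phi>_new r_new \<longleftrightarrow>
     (let \<phi>_hat = extrapolate \<phi>_cur \<phi>_prev in
        bdf2_grid dt \<phi>_new \<phi>_cur \<phi>_prev =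
          grid_lap K (\<lambda>i j k. r_new / sqrt (E1 K \<phi>_hat) * op_N K \<phi>_hat i j k
                              + op_L K a \<phi>_new i j k) \<and>
        bdf2 dt r_new r_cur r_prev =
          1 / (2 * sqrt (E1 K \<phi>_hat)) *
          grid_inner K (op_N K \<phi>_hat) (bdf2_grid dt \<phi>_new \<phi>_cur \<phi>_prev))"

lemma measure_Omega: "measure lebesgue Omega = 1"
proof -
  have "measure lborel (box 0 (1::real^3)) = (\<Prod>b\<in>Basis. (1 - 0 :: real^3) \<bullet> b)"
    by (subst measure_lborel_box_eq) (auto simp: Basis_vec_def inner_axis)
  also have "\<dots> = 1"
    by (intro prod.neutral) (auto simp: Basis_vec_def inner_axis)
  finally show ?thesis by (simp add: Omega_def)
qed

definition grid_exp :: "nat \<Rightarrow> int \<Rightarrow> int \<Rightarrow> complex" where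
  "grid_exp K l i = cis (2 * pi * of_int l * of_int i / real (grid_N K))"

lemma fourier_mode_conv_grid_exp:
  "fourier_mode K l m n i j k = grid_exp K l i * grid_exp K m j * grid_exp K n k"
  by (simp add: fourier_mode_def grid_exp_def cis_mult grid_h_def cis_conv_exp)
    (simp add: algebra_simps exp_add)

lemma grid_exp_add: "grid_exp K (l + l') i = grid_exp K l i * grid_exp K l' i"
  by (simp add: grid_exp_def cis_mult add_divide_distrib algebra_simps)

lemma grid_exp_commute: "grid_exp K l i = grid_exp K i l"
  by (simp add: grid_exp_def algebra_simps)

lemma grid_exp_of_nat: "grid_exp K (int t) d = grid_exp K 1 d ^ t"
  by (simp add: grid_exp_def Complex.DeMoivre algebra_simps)

lemma grid_N_pos: "0 < grid_N K"
  by (simp add: grid_N_def)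

lemma grid_exp_period: "grid_exp K (int (grid_N K)) d = 1"
  using grid_N_pos[of K] cis_multiple_2pi[of "real_of_int d"]
  by (simp add: grid_exp_def mult.assoc)

lemma grid_exp_eq_1_iff: "grid_exp K 1 d = 1 \<longleftrightarrow> int (grid_N K) dvd d"
proof -
  have "cis x = 1 \<longleftrightarrow> cos x = 1" for x :: real
    by (auto simp: complex_eq_iff cos_one_sin_zero)
  then have "grid_exp K 1 d = 1 \<longleftrightarrow> (\<exists>n. 2 * pi * real_of_int d / real (grid_N K) = real_of_int n * 2 * pi)"
    by (simp add: grid_exp_def cos_one_2pi_int)
  also have "\<dots> \<longleftrightarrow> (\<exists>n. real_of_int d = real_of_int (n * int (grid_N K)))"
    using grid_N_pos[of K] by (intro ex_cong1) (simp add: field_simps)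
  also have "\<dots> \<longleftrightarrow> int (grid_N K) dvd d"
    by (simp only: of_int_eq_iff) (auto simp: dvd_def mult.commute)
  finally show ?thesis .
qed

lemma sum_grid_exp:
  "(\<Sum>t<grid_N K. grid_exp K (int t + s) d)
     = (if int (grid_N K) dvd d then of_nat (grid_N K) else 0)"
proof -
  define z where "z = grid_exp K 1 d"
  have *: "(\<Sum>t<grid_N K. grid_exp K (int t + s) d) = (\<Sum>t<grid_N K. z ^ t) * grid_exp K s d"
    by (simp add: grid_exp_add grid_exp_of_nat z_def sum_distrib_right)
  show ?thesis
  proof (cases "int (grid_N K) dvd d")
    case True
    then have "z = 1" by (simp add: z_def grid_exp_eq_1_iff)
    moreover have "grid_exp K s d = 1"
    proof -
      from True obtain c where "d = c * int (grid_N K)" by (auto simp: dvd_def mult.commute)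
      then have "2 * pi * of_int s * of_int d / real (grid_N K) = 2 * pi * of_int (s * c)"
        using grid_N_pos[of K] by simp
      then show ?thesis
        by (simp only: grid_exp_def) (rule cis_multiple_2pi, simp)
    qed
    ultimately show ?thesis using True * by simp
  next
    case False
    then have "z \<noteq> 1" by (simp add: z_def grid_exp_eq_1_iff)
    moreover have "z ^ grid_N K = 1"
      by (simp add: z_def grid_exp_period flip: grid_exp_of_nat)
    ultimately show ?thesis using False * by (simp add: geometric_sum)
  qed
qed

lemma sum_grid_exp_space:
  "(\<Sum>i\<in>{0..<int (grid_N K)}. grid_exp K l i)
     = (if int (grid_N K) dvd l then of_nat (grid_N K) else 0)"
proof -
  have "(\<Sum>i\<in>{0..<int (grid_N K)}. grid_exp K l i) = (\<Sum>t<grid_N K. grid_exp K (int t + 0) l)"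
    by (rule sum.reindex_bij_witness[of _ int nat]) (auto simp: grid_exp_commute)
  then show ?thesis by (simp only: sum_grid_exp)
qed

lemma sum_grid_exp_freq:
  "(\<Sum>l\<in>{-int K..int K}. grid_exp K l d)
     = (if int (grid_N K) dvd d then of_nat (grid_N K) else 0)"
proof -
  have "(\<Sum>l\<in>{-int K..int K}. grid_exp K l d) = (\<Sum>t<grid_N K. grid_exp K (int t + (- int K)) d)"
    by (rule sum.reindex_bij_witness[of _ "\<lambda>t. int t + (- int K)" "\<lambda>l. nat (l + int K)"])
      (auto simp: grid_N_def)
  then show ?thesis by (simp only: sum_grid_exp)
qed

lemma sum3_product:
  fixes a b c :: "int \<Rightarrow> complex"
  shows "(\<Sum>l\<in>A. \<Sum>m\<in>A. \<Sum>n\<in>A. a l * b m * c n) = sum a A * sum b A * sum c A"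
  by (simp only: sum_distrib_left[symmetric] sum_distrib_right[symmetric])

lemma sum3_swap:
  fixes F :: "int \<Rightarrow> int \<Rightarrow> int \<Rightarrow> int \<Rightarrow> int \<Rightarrow> int \<Rightarrow> complex"
  shows "(\<Sum>l\<in>A. \<Sum>m\<in>A. \<Sum>n\<in>A. \<Sum>i\<in>B. \<Sum>j\<in>B. \<Sum>k\<in>B. F l m n i j k)
       = (\<Sum>i\<in>B. \<Sum>j\<in>B. \<Sum>k\<in>B. \<Sum>l\<in>A. \<Sum>m\<in>A. \<Sum>n\<in>A. F l m n i j k)"
proof -
  have sw: "(\<Sum>n\<in>A. \<Sum>i\<in>B. \<Sum>j\<in>B. \<Sum>k\<in>B. G n i j k)
          = (\<Sum>i\<in>B. \<Sum>j\<in>B. \<Sum>k\<in>B. \<Sum>n\<in>A. G n i j k)"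
    for G :: "int \<Rightarrow> int \<Rightarrow> int \<Rightarrow> int \<Rightarrow> complex"
    by (subst sum.swap, rule sum.cong[OF refl], subst sum.swap, rule sum.cong[OF refl],
        rule sum.swap)
  show ?thesis by (simp only: sw)
qed

lemma sum3_delta:
  assumes "finite A" "x \<in> A" "y \<in> A" "z \<in> A"
  shows "(\<Sum>i\<in>A. \<Sum>j\<in>A. \<Sum>k\<in>A. (F i j k :: complex) *
            ((if i = x then M else 0) * (if j = y then M else 0) * (if k = z then M else 0)))
       = F x y z * M ^ 3"
proof -
  have "(\<Sum>i\<in>A. \<Sum>j\<in>A. \<Sum>k\<in>A. F i j k *
            ((if i = x then M else 0) * (if j = y then M else 0) * (if k = z then M else 0)))
     = (\<Sum>i\<in>A. if i = x then \<Sum>j\<in>A. if j = y then \<Sum>k\<in>A. if k = z then F i j k * M ^ 3 else 0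
          else 0 else 0)"
    by (intro sum.cong refl) (auto simp: power3_eq_cube intro!: sum.cong sum.neutral)
  also have "\<dots> = F x y z * M ^ 3"
    using assms by simp
  finally show ?thesis .
qed

lemma grid_fun_mod:
  assumes "f \<in> grid_space K"
  shows "f (i mod int (grid_N K)) (j mod int (grid_N K)) (k mod int (grid_N K)) = f i j k"
proof -
  have per: "g (i mod p) = g i" if g: "\<And>i. g (i + p) = g i" for g :: "int \<Rightarrow> real" and i p
  proof -
    have nat: "g (i + int t * p) = g i" for t i
    proof (induction t)
      case (Suc t)
      have "g (i + int (Suc t) * p) = g ((i + int t * p) + p)"
        by (simp add: distrib_right add_ac)
      with Suc show ?case by (simp only: g)
    qed simp
    have mult: "g (i + c * p) = g i" for c i
    proof (cases "c \<ge> 0")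
      case True
      with nat[of i "nat c"] show ?thesis by simp
    next
      case False
      with nat[of "i + c * p" "nat (-c)"] show ?thesis by simp
    qed
    from mult[of "i mod p" "i div p"] show ?thesis by (simp add: mult.commute)
  qed
  have A: "f (i + int (grid_N K)) j k = f i j k" "f i (j + int (grid_N K)) k = f i j k"
       "f i j (k + int (grid_N K)) = f i j k" for i j k
    using assms by (auto simp: grid_space_def)
  show ?thesis
    using per[of "\<lambda>i. f i (j mod int (grid_N K)) (k mod int (grid_N K))"]
          per[of "\<lambda>j. f i j (k mod int (grid_N K))"] per[of "\<lambda>k. f i j k"] A by simp
qed

lemma grid_h_N: "complex_of_real (grid_h K ^ 3) * of_nat (grid_N K) ^ 3 = 1"
  using grid_N_pos[of K] by (simp add: grid_h_def field_simps)

theorem fourier_expansion: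
  assumes "f \<in> grid_space K"
  shows "complex_of_real (f i j k)
           = freq_sum K (\<lambda>l m n. fourier_coeff K f l m n * fourier_mode K l m n i j k)"
proof -
  let ?N = "int (grid_N K)" and ?M = "of_nat (grid_N K) :: complex"
  let ?h = "complex_of_real (grid_h K ^ 3)"
  have e: "grid_exp K (- l) i' * grid_exp K l i = grid_exp K l (i - i')" for l i i'
    by (simp add: grid_exp_def cis_mult diff_divide_distrib algebra_simps)
  have dl: "?N dvd i - i' \<longleftrightarrow> i' = i mod ?N" if "i' \<in> {0..<?N}" for i i'
    using that by (metis atLeastLessThan_iff mod_eq_dvd_iff mod_pos_pos_trivial)
  have "freq_sum K (\<lambda>l m n. fourier_coeff K f l m n * fourier_mode K l m n i j k)
     = ?h * (\<Sum>l\<in>{-int K..int K}. \<Sum>m\<in>{-int K..int K}. \<Sum>n\<in>{-int K..int K}.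
          \<Sum>i'\<in>{0..<?N}. \<Sum>j'\<in>{0..<?N}. \<Sum>k'\<in>{0..<?N}. complex_of_real (f i' j' k') *
            (grid_exp K l (i - i') * grid_exp K m (j - j') * grid_exp K n (k - k')))"
    unfolding freq_sum_def fourier_coeff_def grid_sum_def
    unfolding sum_distrib_left sum_distrib_right fourier_mode_conv_grid_exp e[symmetric]
    by (intro sum.cong refl) (simp only: mult_ac)
  also have "\<dots> = ?h * (\<Sum>i'\<in>{0..<?N}. \<Sum>j'\<in>{0..<?N}. \<Sum>k'\<in>{0..<?N}. complex_of_real (f i' j' k') *
            (\<Sum>l\<in>{-int K..int K}. \<Sum>m\<in>{-int K..int K}. \<Sum>n\<in>{-int K..int K}.
             grid_exp K l (i - i') * grid_exp K m (j - j') * grid_exp K n (k - k')))"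
    by (subst sum3_swap) (simp only: sum_distrib_left)
  also have "\<dots> = ?h * (\<Sum>i'\<in>{0..<?N}. \<Sum>j'\<in>{0..<?N}. \<Sum>k'\<in>{0..<?N}. complex_of_real (f i' j' k') *
            ((if i' = i mod ?N then ?M else 0) * (if j' = j mod ?N then ?M else 0)
              * (if k' = k mod ?N then ?M else 0)))"
    unfolding sum3_product sum_grid_exp_freq
    by (intro arg_cong[where f = "(*) ?h"] sum.cong refl) (simp only: dl)
  also have "\<dots> = ?h * (complex_of_real (f (i mod ?N) (j mod ?N) (k mod ?N)) * ?M ^ 3)"
    using grid_N_pos[of K] by (subst sum3_delta) auto
  also have "\<dots> = complex_of_real (f i j k)"
    using grid_h_N[of K] unfolding grid_fun_mod[OF assms] by (metis mult.left_commute mult.right_neutral)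
  finally show ?thesis ..
qed

theorem fourier_coeff_unique:
  assumes "\<And>i j k. complex_of_real (f i j k) = freq_sum K (\<lambda>l m n. c l m n * fourier_mode K l m n i j k)"
    and "l \<in> {-int K..int K}" "m \<in> {-int K..int K}" "n \<in> {-int K..int K}"
  shows "c l m n = fourier_coeff K f l m n"
proof -
  let ?N = "int (grid_N K)" and ?M = "of_nat (grid_N K) :: complex" and ?I = "{-int K..int K}"
  let ?h = "complex_of_real (grid_h K ^ 3)"
  have e: "grid_exp K l' i * grid_exp K (- l) i = grid_exp K (l' - l) i" for l l' i
    by (simp add: grid_exp_def cis_mult diff_divide_distrib algebra_simps)
  have dl: "?N dvd l' - l \<longleftrightarrow> l' = l" if "l' \<in> ?I" "l \<in> ?I" for l l'
  proof
    assume "?N dvd l' - l"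
    show "l' = l"
    proof (rule ccontr)
      assume "l' \<noteq> l"
      with \<open>?N dvd l' - l\<close> have "\<bar>?N\<bar> \<le> \<bar>l' - l\<bar>"
        by (intro dvd_imp_le_int) auto
      with that show False by (auto simp: grid_N_def)
    qed
  qed auto
  have "fourier_coeff K f l m n = ?h * (\<Sum>i\<in>{0..<?N}. \<Sum>j\<in>{0..<?N}. \<Sum>k\<in>{0..<?N}.
     \<Sum>l'\<in>?I. \<Sum>m'\<in>?I. \<Sum>n'\<in>?I. c l' m' n' *
       (grid_exp K (l' - l) i * grid_exp K (m' - m) j * grid_exp K (n' - n) k))"
    unfolding freq_sum_def fourier_coeff_def grid_sum_def assms(1)
    unfolding sum_distrib_left sum_distrib_right fourier_mode_conv_grid_exp e[symmetric]
    by (intro sum.cong refl) (simp only: mult_ac)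
  also have "\<dots> = ?h * (\<Sum>l'\<in>?I. \<Sum>m'\<in>?I. \<Sum>n'\<in>?I. c l' m' n' *
     (\<Sum>i\<in>{0..<?N}. \<Sum>j\<in>{0..<?N}. \<Sum>k\<in>{0..<?N}.
       grid_exp K (l' - l) i * grid_exp K (m' - m) j * grid_exp K (n' - n) k))"
    by (subst sum3_swap) (simp only: sum_distrib_left)
  also have "\<dots> = ?h * (\<Sum>l'\<in>?I. \<Sum>m'\<in>?I. \<Sum>n'\<in>?I. c l' m' n' *
     ((if l' = l then ?M else 0) * (if m' = m then ?M else 0) * (if n' = n then ?M else 0)))"
    unfolding sum3_product sum_grid_exp_space
    by (intro arg_cong[where f = "(*) ?h"] sum.cong refl) (simp only: dl assms)
  also have "\<dots> = ?h * (c l m n * ?M ^ 3)"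
    using assms by (subst sum3_delta) auto
  also have "\<dots> = c l m n"
    using grid_h_N[of K] by (metis mult.left_commute mult.right_neutral)
  finally show ?thesis ..
qed

lemma cnj_fourier_mode: "cnj (fourier_mode K l m n i j k) = fourier_mode K (-l) (-m) (-n) i j k"
  by (simp add: fourier_mode_conv_grid_exp grid_exp_def cis_cnj)

theorem spectral_sum_real:
  assumes "\<And>l m n. cnj (s l m n) = s (-l) (-m) (-n)"
  shows "spectral_sum K s f i j k \<in> \<real>"
proof -
  have coeff: "cnj (fourier_coeff K f l m n) = fourier_coeff K f (-l) (-m) (-n)" for l m n
    by (simp add: fourier_coeff_def grid_sum_def cnj_fourier_mode)
  have neg: "(\<Sum>l\<in>{-int K..int K}. F (-l)) = (\<Sum>l\<in>{-int K..int K}. F l)"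
    for F :: "int \<Rightarrow> complex"
    by (rule sum.reindex_bij_witness[of _ uminus uminus]) auto
  let ?G = "\<lambda>l m n. s l m n * fourier_coeff K f l m n * fourier_mode K l m n i j k"
  have "cnj (spectral_sum K s f i j k)
      = (\<Sum>l\<in>{-int K..int K}. \<Sum>m\<in>{-int K..int K}. \<Sum>n\<in>{-int K..int K}. ?G (-l) (-m) (-n))"
    by (simp add: spectral_sum_def freq_sum_def assms coeff cnj_fourier_mode)
  also have "\<dots> = (\<Sum>l\<in>{-int K..int K}. \<Sum>m\<in>{-int K..int K}. \<Sum>n\<in>{-int K..int K}. ?G (-l) (-m) n)"
    by (intro sum.cong refl neg)
  also have "\<dots> = (\<Sum>l\<in>{-int K..int K}. \<Sum>m\<in>{-int K..int K}. \<Sum>n\<in>{-int K..int K}. ?G (-l) m n)"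
    by (intro sum.cong refl neg[of "\<lambda>m. \<Sum>n\<in>{-int K..int K}. ?G _ m n"])
  also have "\<dots> = spectral_sum K s f i j k"
    unfolding spectral_sum_def freq_sum_def
    by (rule neg[of "\<lambda>l. \<Sum>m\<in>{-int K..int K}. \<Sum>n\<in>{-int K..int K}. ?G l m n"])
  finally show ?thesis by (simp add: Reals_cnj_iff)
qed

corollary D_complex:
  "complex_of_real (D_x K f i j k)
     = spectral_sum K (\<lambda>l m n. 2 * complex_of_real pi * \<i> * of_int l) f i j k"
  "complex_of_real (D_y K f i j k)
     = spectral_sum K (\<lambda>l m n. 2 * complex_of_real pi * \<i> * of_int m) f i j k"
  "complex_of_real (D_z K f i j k)
     = spectral_sum K (\<lambda>l m n. 2 * complex_of_real pi * \<i> * of_int n) f i j k"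
  by (simp_all add: D_x_def D_y_def D_z_def spectral_sum_real of_real_Re)

end

theory Submission imports Defs begin

text \<open>
  Every operator in the scheme except \<open>op_N\<close> is diagonal in the discrete Fourier basis, and
  \<open>op_N\<close> acts only on known data. With \<open>B\<close> the known nonlinear term divided by the square root of
  the energy, and \<open>\<lambda> = 4 \<pi>\<^sup>2 (l\<^sup>2 + m\<^sup>2 + n\<^sup>2) \<ge> 0\<close> the symbol of \<open>- \<Delta>\<^sub>N\<close>, the first equation reads,
  on each Fourier coefficient,
  \<open>(3 + 2 dt \<lambda> (a + \<lambda>\<^sup>2)) \<phi>\<^sup>n\<^sup>+\<^sup>1 = - 2 dt \<lambda> r\<^sup>n\<^sup>+\<^sup>1 B + 4 \<phi>\<^sup>n - \<phi>\<^sup>n\<^sup>-\<^sup>1\<close>.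
  The factor on the left is at least \<open>3\<close>, so \<open>\<phi>\<^sup>n\<^sup>+\<^sup>1 = r\<^sup>n\<^sup>+\<^sup>1 W + G\<close> with \<open>W\<close> and \<open>G\<close> known
  (\<open>first_equation_solved\<close>). Substituting this into the second equation leaves one scalar linear
  equation for \<open>r\<^sup>n\<^sup>+\<^sup>1\<close>, with leading coefficient \<open>3/2 - 3/4 \<langle>B, W\<rangle>\<close>. Since \<open>W\<close> arises from \<open>B\<close> by a
  nonpositive Fourier multiplier, \<open>\<langle>B, W\<rangle> \<le> 0\<close> by Parseval's identity
  (\<open>grid_inner_multiplier_nonpos\<close>), so the coefficient is positive and \<open>r\<^sup>n\<^sup>+\<^sup>1\<close>, hence
  \<open>\<phi>\<^sup>n\<^sup>+\<^sup>1\<close>, exists and is unique.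

  The mean is the Fourier coefficient at frequency zero, which \<open>\<Delta>\<^sub>N\<close> annihilates. So the means obey
  \<open>3/2 \<beta>\<^sup>n\<^sup>+\<^sup>1 - 2 \<beta>\<^sup>n + 1/2 \<beta>\<^sup>n\<^sup>-\<^sup>1 = 0\<close>, and two equal initial means propagate.
\<close>

section \<open>Fourier coefficients of grid functions\<close>

lemma fourier_coeff_add:
  "fourier_coeff K (\<lambda>i j k. f i j k + g i j k) l m n
     = fourier_coeff K f l m n + fourier_coeff K g l m n"
  by (simp add: fourier_coeff_def grid_sum_def sum.distrib distrib_right distrib_left)

lemma fourier_coeff_scale:
  "fourier_coeff K (\<lambda>i j k. c * f i j k) l m n = of_real c * fourier_coeff K f l m n"
  by (simp add: fourier_coeff_def grid_sum_def sum_distrib_left mult_ac)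

lemma fourier_coeff_zero_freq: "fourier_coeff K f 0 0 0 = of_real (grid_mean K f)"
  by (simp add: fourier_coeff_def grid_mean_def grid_inner_def grid_sum_def fourier_mode_def)

lemma cnj_fourier_coeff: "cnj (fourier_coeff K f l m n) = fourier_coeff K f (-l) (-m) (-n)"
  by (simp add: fourier_coeff_def grid_sum_def cnj_fourier_mode)

lemma grid_space_lincomb:
  assumes "f \<in> grid_space K" "g \<in> grid_space K"
  shows "(\<lambda>i j k. c * f i j k + d * g i j k) \<in> grid_space K"
  using assms by (simp add: grid_space_def)

lemma grid_fun_eqI:
  assumes "f \<in> grid_space K" "g \<in> grid_space K"
    and "\<And>l m n. \<lbrakk>l \<in> {-int K..int K}; m \<in> {-int K..int K}; n \<in> {-int K..int K}\<rbrakk>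
           \<Longrightarrow> fourier_coeff K f l m n = fourier_coeff K g l m n"
  shows "f = g"
proof (intro ext)
  fix i j k
  have "complex_of_real (f i j k) = complex_of_real (g i j k)"
    unfolding fourier_expansion[OF assms(1)] fourier_expansion[OF assms(2)] freq_sum_def
    by (intro sum.cong refl) (simp add: assms(3))
  then show "f i j k = g i j k" by simp
qed

section \<open>Fourier multipliers\<close>

text \<open>
  The symmetry under which a multiplier maps real grid functions to real ones, so that taking real
  parts in \<open>multiplier\<close> below loses nothing and multipliers compose by multiplying symbols.
\<close>

definition hermitian :: "(int \<Rightarrow> int \<Rightarrow> int \<Rightarrow> complex) \<Rightarrow> bool" where
  "hermitian s \<longleftrightarrow> (\<forall>l m n. cnj (s l m n) = s (-l) (-m) (-n))"

definition multiplier ::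
  "nat \<Rightarrow> (int \<Rightarrow> int \<Rightarrow> int \<Rightarrow> complex) \<Rightarrow> real grid_fun \<Rightarrow> real grid_fun" where
  "multiplier K s f i j k = Re (spectral_sum K s f i j k)"

lemma of_real_multiplier:
  assumes "hermitian s"
  shows "complex_of_real (multiplier K s f i j k) = spectral_sum K s f i j k"
  using assms by (simp add: multiplier_def hermitian_def spectral_sum_real of_real_Re)

lemma fourier_coeff_multiplier:
  assumes "hermitian s" "l \<in> {-int K..int K}" "m \<in> {-int K..int K}" "n \<in> {-int K..int K}"
  shows "fourier_coeff K (multiplier K s f) l m n = s l m n * fourier_coeff K f l m n"
  by (rule fourier_coeff_unique[symmetric, OF _ assms(2-4)])
    (simp add: of_real_multiplier[OF assms(1)] spectral_sum_def)

lemma grid_exp_add_period: "grid_exp K l (i + int (grid_N K)) = grid_exp K l i"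
proof -
  have "grid_exp K l (int (grid_N K)) = 1"
    by (simp only: grid_exp_commute[of K l] grid_exp_period)
  then show ?thesis by (metis grid_exp_add grid_exp_commute mult.right_neutral)
qed

lemma multiplier_in_grid_space: "multiplier K s f \<in> grid_space K"
  by (simp add: grid_space_def multiplier_def spectral_sum_def fourier_mode_conv_grid_exp
      grid_exp_add_period)

lemma multiplier_multiplier:
  assumes "hermitian t"
  shows "multiplier K s (multiplier K t f) = multiplier K (\<lambda>l m n. s l m n * t l m n) f"
proof (intro ext)
  fix i j k
  have "spectral_sum K s (multiplier K t f) i j k
      = spectral_sum K (\<lambda>l m n. s l m n * t l m n) f i j k"
    unfolding spectral_sum_def freq_sum_def
    by (intro sum.cong refl) (simp add: fourier_coeff_multiplier[OF assms])
  then show "multiplier K s (multiplier K t f) i j k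
      = multiplier K (\<lambda>l m n. s l m n * t l m n) f i j k"
    by (simp add: multiplier_def)
qed

lemma multiplier_add:
  "multiplier K s f i j k + multiplier K t f i j k = multiplier K (\<lambda>l m n. s l m n + t l m n) f i j k"
  by (simp add: multiplier_def spectral_sum_def freq_sum_def distrib_right sum.distrib)

text \<open>
  Parseval's identity for a multiplier: exchanging the sums over grid points and frequencies turns
  the sum of \<open>f\<close> against the mode \<open>(l, m, n)\<close> into the coefficient at \<open>(-l, -m, -n)\<close>, which is the
  conjugate of the one at \<open>(l, m, n)\<close> because \<open>f\<close> is real.
\<close>

lemma grid_inner_multiplier:
  assumes "hermitian s"
  shows "complex_of_real (grid_inner K f (multiplier K s f))
       = freq_sum K (\<lambda>l m n. s l m n * of_real ((cmod (fourier_coeff K f l m n))\<^sup>2))"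
proof -
  let ?N = "int (grid_N K)" and ?I = "{-int K..int K}"
  let ?h = "complex_of_real (grid_h K ^ 3)" and ?c = "fourier_coeff K f"
  have "complex_of_real (grid_inner K f (multiplier K s f))
     = (\<Sum>i\<in>{0..<?N}. \<Sum>j\<in>{0..<?N}. \<Sum>k\<in>{0..<?N}. \<Sum>l\<in>?I. \<Sum>m\<in>?I. \<Sum>n\<in>?I.
          s l m n * ?c l m n * (?h * (of_real (f i j k) * fourier_mode K l m n i j k)))"
    unfolding grid_inner_def grid_sum_def of_real_mult of_real_sum of_real_multiplier[OF assms]
      spectral_sum_def freq_sum_def sum_distrib_left
    by (intro sum.cong refl) (simp only: mult_ac)
  also have "\<dots> = (\<Sum>l\<in>?I. \<Sum>m\<in>?I. \<Sum>n\<in>?I. s l m n * ?c l m n * ?c (-l) (-m) (-n))"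
    unfolding fourier_coeff_def[of K f "- _"] grid_sum_def sum_distrib_left minus_minus
    by (rule sum3_swap[symmetric])
  also have "\<dots> = freq_sum K (\<lambda>l m n. s l m n * of_real ((cmod (?c l m n))\<^sup>2))"
    unfolding freq_sum_def cnj_fourier_coeff[symmetric]
    by (simp only: mult.assoc complex_norm_square)
  finally show ?thesis .
qed

lemma grid_inner_multiplier_nonpos:
  assumes "hermitian (\<lambda>l m n. complex_of_real (\<sigma> l m n))" and "\<And>l m n. \<sigma> l m n \<le> 0"
  shows "grid_inner K f (multiplier K (\<lambda>l m n. complex_of_real (\<sigma> l m n)) f) \<le> 0"
proof -
  have "grid_inner K f (multiplier K (\<lambda>l m n. complex_of_real (\<sigma> l m n)) f)
     = Re (freq_sum K (\<lambda>l m n. of_real (\<sigma> l m n) * of_real ((cmod (fourier_coeff K f l m n))\<^sup>2)))"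
    using arg_cong[OF grid_inner_multiplier[OF assms(1)], of Re] by simp
  also have "\<dots> \<le> 0"
    by (auto simp: freq_sum_def intro!: sum_nonpos mult_nonpos_nonneg assms(2))
  finally show ?thesis .
qed

section \<open>The discrete Laplacian\<close>

definition neg_lap_symbol :: "int \<Rightarrow> int \<Rightarrow> int \<Rightarrow> real" where
  "neg_lap_symbol l m n = 4 * pi\<^sup>2 * ((of_int l)\<^sup>2 + (of_int m)\<^sup>2 + (of_int n)\<^sup>2)"

lemma neg_lap_symbol_nonneg: "0 \<le> neg_lap_symbol l m n"
  by (simp add: neg_lap_symbol_def)

lemma hermitian_neg_lap: "hermitian (\<lambda>l m n. complex_of_real (F (neg_lap_symbol l m n)))"
  by (simp add: hermitian_def neg_lap_symbol_def)

lemma grid_lap_eq_multiplier: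
  "grid_lap K f = multiplier K (\<lambda>l m n. complex_of_real (- neg_lap_symbol l m n)) f"
proof -
  define d where "d = (\<lambda>x::int. 2 * complex_of_real pi * \<i> * of_int x)"
  have D: "D_x K = multiplier K (\<lambda>l m n. d l)" "D_y K = multiplier K (\<lambda>l m n. d m)"
    "D_z K = multiplier K (\<lambda>l m n. d n)"
    by (auto simp: fun_eq_iff D_x_def D_y_def D_z_def multiplier_def d_def)
  have h: "hermitian (\<lambda>l m n. d l)" "hermitian (\<lambda>l m n. d m)" "hermitian (\<lambda>l m n. d n)"
    by (auto simp: hermitian_def d_def)
  have "d l * d l + d m * d m + d n * d n = complex_of_real (- neg_lap_symbol l m n)" for l m n
    by (simp add: d_def neg_lap_symbol_def complex_eq_iff power2_eq_square algebra_simps)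
  then show ?thesis
    by (simp add: fun_eq_iff grid_lap_def grid_div_def grid_grad_def D multiplier_multiplier h
        multiplier_add)
qed

lemma fourier_coeff_lap:
  assumes "l \<in> {-int K..int K}" "m \<in> {-int K..int K}" "n \<in> {-int K..int K}"
  shows "fourier_coeff K (grid_lap K f) l m n
           = - of_real (neg_lap_symbol l m n) * fourier_coeff K f l m n"
  unfolding grid_lap_eq_multiplier
  by (subst fourier_coeff_multiplier) (use assms hermitian_neg_lap[of "\<lambda>x. - x"] in auto)

lemma grid_mean_lap: "grid_mean K (grid_lap K f) = 0"
  using fourier_coeff_lap[of 0 K 0 0 f] by (simp add: fourier_coeff_zero_freq neg_lap_symbol_def)

section \<open>Solving one step of the scheme\<close>

text \<open>
  With \<open>x\<close> in place of \<open>- \<Delta>\<^sub>N\<close>, this is the operator that acts on the new time level once the first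
  equation is multiplied by \<open>2 dt\<close> and the implicit linear terms are collected on the left. The two
  definitions after it apply its inverse to \<open>2 dt \<Delta>\<^sub>N B\<close>, the term that the new scalar multiplies,
  and to the contribution \<open>4 \<phi>\<^sup>n - \<phi>\<^sup>n\<^sup>-\<^sup>1\<close> of the two old time levels.
\<close>

definition step_denom :: "real \<Rightarrow> real \<Rightarrow> real \<Rightarrow> real" where
  "step_denom a dt x = 3 + 2 * dt * x * (a + x\<^sup>2)"

definition step_response :: "nat \<Rightarrow> real \<Rightarrow> real \<Rightarrow> real grid_fun \<Rightarrow> real grid_fun" where
  "step_response K a dt =
     multiplier K (\<lambda>l m n. of_real (- (2 * dt * neg_lap_symbol l m n)
                                      / step_denom a dt (neg_lap_symbol l m n)))"

definition step_history ::
  "nat \<Rightarrow> real \<Rightarrow> real \<Rightarrow> real grid_fun \<Rightarrow> real grid_fun \<Rightarrow> real grid_fun" where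
  "step_history K a dt \<phi>_cur \<phi>_prev =
     multiplier K (\<lambda>l m n. of_real (1 / step_denom a dt (neg_lap_symbol l m n)))
       (\<lambda>i j k. 4 * \<phi>_cur i j k + (- 1) * \<phi>_prev i j k)"

lemma step_denom_pos:
  assumes "0 < a" "0 < dt" "0 \<le> x"
  shows "0 < step_denom a dt x"
  unfolding step_denom_def using assms by (intro add_pos_nonneg) auto

lemma fourier_coeff_bdf2_grid:
  "fourier_coeff K (bdf2_grid dt u v w) l m n
     = (3 / 2 * fourier_coeff K u l m n - 2 * fourier_coeff K v l m n
        + 1 / 2 * fourier_coeff K w l m n) / of_real dt"
proof -
  have "bdf2_grid dt u v w
      = (\<lambda>i j k. (1 / dt) * ((3 / 2 * u i j k + (- 2) * v i j k) + 1 / 2 * w i j k))"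
    by (simp add: fun_eq_iff bdf2_grid_def bdf2_def)
  then show ?thesis
    by (simp only: fourier_coeff_scale fourier_coeff_add) (simp add: field_simps)
qed

lemma bdf2_grid_in_grid_space:
  assumes "u \<in> grid_space K" "v \<in> grid_space K" "w \<in> grid_space K"
  shows "bdf2_grid dt u v w \<in> grid_space K"
  using assms by (simp add: grid_space_def bdf2_grid_def)

text \<open>
  Both sides of the first equation are periodic, so the equation may be read off coefficient by
  coefficient, where it is a scalar linear equation with leading coefficient \<open>step_denom\<close>.
\<close>

lemma first_equation_solved:
  assumes "0 < a" "0 < dt"
    and \<phi>: "\<phi>_new \<in> grid_space K" "\<phi>_cur \<in> grid_space K" "\<phi>_prev \<in> grid_space K"
  shows "bdf2_grid dt \<phi>_new \<phi>_cur \<phi>_prev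
           = grid_lap K (\<lambda>i j k. r * B i j k + op_L K a \<phi>_new i j k)
         \<longleftrightarrow> \<phi>_new = (\<lambda>i j k. r * step_response K a dt B i j k
                                   + 1 * step_history K a dt \<phi>_cur \<phi>_prev i j k)"
    (is "?lhs = ?rhs \<longleftrightarrow> _ = ?sol")
proof -
  let ?I = "{-int K..int K}"
  have grid: "?lhs \<in> grid_space K" "?rhs \<in> grid_space K" "?sol \<in> grid_space K"
    unfolding step_response_def step_history_def grid_lap_eq_multiplier
    by (intro grid_space_lincomb multiplier_in_grid_space bdf2_grid_in_grid_space \<phi>)+
  have key: "fourier_coeff K ?lhs l m n = fourier_coeff K ?rhs l m n
         \<longleftrightarrow> fourier_coeff K \<phi>_new l m n = fourier_coeff K ?sol l m n"
    if I: "l \<in> ?I" "m \<in> ?I" "n \<in> ?I" for l m n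
  proof -
    define x where "x = neg_lap_symbol l m n"
    define u v w b where "u = fourier_coeff K \<phi>_new l m n" and "v = fourier_coeff K \<phi>_cur l m n"
      and "w = fourier_coeff K \<phi>_prev l m n" and "b = fourier_coeff K B l m n"
    define p where "p = complex_of_real (step_denom a dt x)"
    have p0: "p \<noteq> 0"
      using step_denom_pos[OF assms(1,2), of x] by (simp add: p_def x_def neg_lap_symbol_nonneg)
    have p: "p = 3 + 2 * of_real dt * of_real x * (of_real a + of_real x * of_real x)"
      by (simp add: p_def step_denom_def power2_eq_square)
    have R: "fourier_coeff K (step_response K a dt B) l m n = - (2 * of_real dt * of_real x) / p * b"
      unfolding step_response_def
      by (subst fourier_coeff_multiplier[OF hermitian_neg_lap I]) (simp add: p_def b_def x_def)
    have H: "fourier_coeff K (step_history K a dt \<phi>_cur \<phi>_prev) l m n = (4 * v - w) / p"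
      unfolding step_history_def
      by (subst fourier_coeff_multiplier[OF hermitian_neg_lap I], subst fourier_coeff_add)
        (simp only: fourier_coeff_scale, simp add: p_def v_def w_def x_def)
    have sol: "fourier_coeff K ?sol l m n = (4 * v - w - 2 * of_real dt * of_real x * of_real r * b) / p"
      unfolding fourier_coeff_add fourier_coeff_scale R H
      using p0 by (simp add: field_simps)
    have "u = fourier_coeff K ?sol l m n
        \<longleftrightarrow> u * p = 4 * v - w - 2 * of_real dt * of_real x * of_real r * b"
      by (simp only: sol nonzero_eq_divide_eq[OF p0])
    moreover have "fourier_coeff K ?lhs l m n = (3 / 2 * u - 2 * v + 1 / 2 * w) / of_real dt"
      by (simp add: fourier_coeff_bdf2_grid u_def v_def w_def)
    moreover have "fourier_coeff K ?rhs l m n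
        = - of_real x * (of_real r * b + (of_real a * u + of_real x * of_real x * u))"
      unfolding op_L_def
      by (simp add: fourier_coeff_lap[OF I] fourier_coeff_add fourier_coeff_scale
          u_def b_def x_def mult_ac)
    moreover have "(3 / 2 * u - 2 * v + 1 / 2 * w) / of_real dt
          = - of_real x * (of_real r * b + (of_real a * u + of_real x * of_real x * u))
        \<longleftrightarrow> u * p = 4 * v - w - 2 * of_real dt * of_real x * of_real r * b"
    proof -
      have clear_dt: "(3 / 2 * u - 2 * v + 1 / 2 * w) / of_real dt = y
          \<longleftrightarrow> 3 * u - 4 * v + w = 2 * of_real dt * y" for y
        using \<open>0 < dt\<close> by (auto simp: field_simps)
      (* The difference of the two sides of one equation is that of the other. *)
      show ?thesis
        unfolding p clear_dt
        by (subst (1 2) eq_iff_diff_eq_0) (simp add: algebra_simps)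
    qed
    ultimately show ?thesis by (simp only: u_def)
  qed
  show ?thesis
  proof
    assume "?lhs = ?rhs"
    then have "fourier_coeff K ?lhs l m n = fourier_coeff K ?rhs l m n" for l m n
      by (rule arg_cong)
    with key show "\<phi>_new = ?sol"
      by (intro grid_fun_eqI[OF \<phi>(1) grid(3)]) (rule iffD1)
  next
    assume "\<phi>_new = ?sol"
    then have "fourier_coeff K \<phi>_new l m n = fourier_coeff K ?sol l m n" for l m n
      by (rule arg_cong)
    with key show "?lhs = ?rhs"
      by (intro grid_fun_eqI[OF grid(1,2)]) (rule iffD2)
  qed
qed

text \<open>
  The Laplacian contributes a nonpositive symbol and the inverse of the implicit operator a positive
  one. This sign is what makes the coupling between the grid function and the scalar solvable.
\<close>

lemma grid_inner_step_response_nonpos: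
  assumes "0 < a" "0 < dt"
  shows "grid_inner K B (step_response K a dt B) \<le> 0"
  unfolding step_response_def
  by (rule grid_inner_multiplier_nonpos[OF hermitian_neg_lap])
    (use assms step_denom_pos[OF assms neg_lap_symbol_nonneg] neg_lap_symbol_nonneg
      in \<open>simp add: divide_nonneg_pos\<close>)

lemma grid_inner_lincomb:
  "grid_inner K f (\<lambda>i j k. c * g i j k + d * h i j k) = c * grid_inner K f g + d * grid_inner K f h"
  by (simp add: grid_inner_def grid_sum_def sum.distrib sum_distrib_left distrib_left mult_ac)

lemma grid_inner_scale_left:
  "grid_inner K (\<lambda>i j k. c * f i j k) g = c * grid_inner K f g"
  by (simp add: grid_inner_def grid_sum_def sum_distrib_left mult_ac)

text \<open>
  After elimination of \<open>\<phi>_new = r W + G\<close>, the second equation is affine in \<open>r\<close>; the positive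
  leading coefficient comes from \<open>grid_inner_step_response_nonpos\<close>.
\<close>

lemma second_equation_ex1:
  assumes "0 < a" "0 < dt"
  shows "\<exists>!r. bdf2 dt r r_cur r_prev = 1 / 2 * grid_inner K B
           (bdf2_grid dt (\<lambda>i j k. r * step_response K a dt B i j k + 1 * G i j k) \<phi>_cur \<phi>_prev)"
proof -
  let ?W = "step_response K a dt B"
  define S where "S = grid_inner K B (bdf2_grid dt G \<phi>_cur \<phi>_prev)"
  define q where "q = 3 / 2 - 3 / 4 * grid_inner K B ?W"
  have q: "0 < q"
    using grid_inner_step_response_nonpos[OF assms, of K B] by (simp add: q_def)
  have "bdf2_grid dt (\<lambda>i j k. r * ?W i j k + 1 * G i j k) \<phi>_cur \<phi>_prev
      = (\<lambda>i j k. (3 / 2 * r / dt) * ?W i j k + 1 * bdf2_grid dt G \<phi>_cur \<phi>_prev i j k)" for r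
    using \<open>0 < dt\<close> by (simp add: fun_eq_iff bdf2_grid_def bdf2_def field_simps)
  then have "1 / 2 * grid_inner K B (bdf2_grid dt (\<lambda>i j k. r * ?W i j k + 1 * G i j k) \<phi>_cur \<phi>_prev)
        = (3 / 4 * r * grid_inner K B ?W + dt / 2 * S) / dt" for r
    using \<open>0 < dt\<close> by (simp only: grid_inner_lincomb S_def[symmetric]) (simp add: field_simps)
  then have "bdf2 dt r r_cur r_prev = 1 / 2 * grid_inner K B
           (bdf2_grid dt (\<lambda>i j k. r * ?W i j k + 1 * G i j k) \<phi>_cur \<phi>_prev)
        \<longleftrightarrow> 3 / 2 * r - 2 * r_cur + 1 / 2 * r_prev = 3 / 4 * r * grid_inner K B ?W + dt / 2 * S" for r
    using \<open>0 < dt\<close> by (simp only: bdf2_def) simp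
  moreover have "3 / 2 * r - 2 * r_cur + 1 / 2 * r_prev = 3 / 4 * r * grid_inner K B ?W + dt / 2 * S
        \<longleftrightarrow> r = (2 * r_cur - 1 / 2 * r_prev + dt / 2 * S) / q" for r
  proof -
    have "r * q = 3 / 2 * r - 3 / 4 * r * grid_inner K B ?W"
      by (simp add: q_def algebra_simps)
    then show ?thesis using q by (auto simp: eq_divide_eq)
  qed
  ultimately show ?thesis by simp
qed

lemma sav_scheme_step_ex1:
  assumes "0 < a" "0 < dt" "\<phi>_prev \<in> grid_space K" "\<phi>_cur \<in> grid_space K"
  shows "\<exists>!p. case p of (\<phi>_new, r_new) \<Rightarrow>
           \<phi>_new \<in> grid_space K \<and> sav_scheme K a dt \<phi>_prev \<phi>_cur r_prev r_cur \<phi>_new r_new"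
proof -
  define hat where "hat = extrapolate \<phi>_cur \<phi>_prev"
  define B where "B = (\<lambda>i j k. 1 / sqrt (E1 K hat) * op_N K hat i j k)"
  define sol where "sol r = (\<lambda>i j k. r * step_response K a dt B i j k
                                   + 1 * step_history K a dt \<phi>_cur \<phi>_prev i j k)" for r
  define Q where "Q = (\<lambda>\<phi> r. bdf2 dt r r_cur r_prev
                         = 1 / 2 * grid_inner K B (bdf2_grid dt \<phi> \<phi>_cur \<phi>_prev))"
  have sol_grid: "sol r \<in> grid_space K" for r
    unfolding sol_def step_response_def step_history_def
    by (intro grid_space_lincomb multiplier_in_grid_space)
  have "\<phi> \<in> grid_space K \<and> sav_scheme K a dt \<phi>_prev \<phi>_cur r_prev r_cur \<phi> r
          \<longleftrightarrow> \<phi> = sol r \<and> Q (sol r) r" for \<phi> r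
  proof -
    have "sav_scheme K a dt \<phi>_prev \<phi>_cur r_prev r_cur \<phi> r
        \<longleftrightarrow> bdf2_grid dt \<phi> \<phi>_cur \<phi>_prev = grid_lap K (\<lambda>i j k. r * B i j k + op_L K a \<phi> i j k)
            \<and> Q \<phi> r"
      unfolding sav_scheme_def Let_def hat_def[symmetric] Q_def B_def grid_inner_scale_left by simp
    then show ?thesis
      using first_equation_solved[OF assms(1,2) _ assms(4,3), of \<phi> r B] sol_grid[of r]
      unfolding sol_def[symmetric] by auto
  qed
  moreover have "\<exists>!r. Q (sol r) r"
    unfolding Q_def sol_def by (rule second_equation_ex1[OF assms(1,2)])
  ultimately show ?thesis by auto
qed

section \<open>Conservation of mass\<close>

lemma sav_scheme_mean:
  assumes "0 < dt" "sav_scheme K a dt \<phi>_prev \<phi>_cur r_prev r_cur \<phi>_new r_new"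
  shows "3 / 2 * grid_mean K \<phi>_new - 2 * grid_mean K \<phi>_cur + 1 / 2 * grid_mean K \<phi>_prev = 0"
proof -
  have "grid_mean K (bdf2_grid dt \<phi>_new \<phi>_cur \<phi>_prev) = 0"
    using assms(2) unfolding sav_scheme_def Let_def by (simp add: grid_mean_lap)
  then have "complex_of_real (3 / 2 * grid_mean K \<phi>_new - 2 * grid_mean K \<phi>_cur
               + 1 / 2 * grid_mean K \<phi>_prev) = 0"
    using fourier_coeff_bdf2_grid[of K dt \<phi>_new \<phi>_cur \<phi>_prev 0 0 0] assms(1)
    by (simp add: fourier_coeff_zero_freq)
  then show ?thesis by (simp only: of_real_eq_0_iff)
qed

lemma sav_scheme_mass_conservation:
  fixes \<phi> :: "int \<Rightarrow> real grid_fun"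
  assumes "0 < dt" and "grid_mean K (\<phi> (-1)) = \<beta>" "grid_mean K (\<phi> 0) = \<beta>"
    and scheme: "\<And>n. 0 \<le> n \<Longrightarrow>
      sav_scheme K a dt (\<phi> (n - 1)) (\<phi> n) (r (n - 1)) (r n) (\<phi> (n + 1)) (r (n + 1))"
    and "0 \<le> k"
  shows "grid_mean K (\<phi> k) = \<beta>"
proof -
  (* Each new mean depends on the two preceding ones, so both are carried through the induction. *)
  have "grid_mean K (\<phi> (k - 1)) = \<beta> \<and> grid_mean K (\<phi> k) = \<beta>"
    using \<open>0 \<le> k\<close>
  proof (induction k rule: int_ge_induct)
    case base
    show ?case using assms(2,3) by simp
  next
    case (step k)
    then show ?case using sav_scheme_mean[OF assms(1) scheme[of k]] by simp
  qed
  then show ?thesis ..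
qed

theorem theorem2p5:
  fixes K :: nat and \<epsilon> a dt :: real
  assumes "0 < \<epsilon>" and "\<epsilon> < 1" and "a = 1 - \<epsilon>" and "0 < dt"
  shows "(\<forall>\<phi>_prev \<phi>_cur r_prev r_cur.
            \<phi>_prev \<in> grid_space K \<longrightarrow> \<phi>_cur \<in> grid_space K \<longrightarrow>
            grid_mean K \<phi>_cur = grid_mean K \<phi>_prev \<longrightarrow>
            (\<exists>!p. case p of (\<phi>_new, r_new) \<Rightarrow>
               \<phi>_new \<in> grid_space K \<and>
               sav_scheme K a dt \<phi>_prev \<phi>_cur r_prev r_cur \<phi>_new r_new))
       \<and> (\<forall>(\<phi> :: int \<Rightarrow> real grid_fun) (r :: int \<Rightarrow> real) \<beta>\<^sub>0.
            (\<forall>n\<ge>-1. \<phi> n \<in> grid_space K) \<longrightarrow>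
            grid_mean K (\<phi> (-1)) = \<beta>\<^sub>0 \<longrightarrow> grid_mean K (\<phi> 0) = \<beta>\<^sub>0 \<longrightarrow>
            (\<forall>n\<ge>0. sav_scheme K a dt (\<phi> (n - 1)) (\<phi> n) (r (n - 1)) (r n)
                                    (\<phi> (n + 1)) (r (n + 1))) \<longrightarrow>
            (\<forall>k\<ge>0. grid_mean K (\<phi> k) = grid_mean K (\<phi> 0) \<and> grid_mean K (\<phi> 0) = \<beta>\<^sub>0))"
proof (intro conjI allI impI, goal_cases)
  case (1 \<phi>_prev \<phi>_cur r_prev r_cur)
  show ?case
    by (rule sav_scheme_step_ex1) (use assms 1 in auto)
next
  case (2 \<phi> r \<beta>\<^sub>0 k)
  then have "grid_mean K (\<phi> k) = \<beta>\<^sub>0"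
    by (intro sav_scheme_mass_conservation[OF \<open>0 < dt\<close>, of K \<phi> \<beta>\<^sub>0 a r k]) auto
  then show ?case using 2(3) by simp
next
  case 3
  then show ?case by simp
qed

end
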